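(* Let $X$ be an exchangeable random network on a finite node set $\mathcal{N}$. Then the dependence skeleton $\mathrm{sk}(X)$ is one of the following graphs with vertex set $D(\mathcal{N})$: (a) the empty graph (no edges); (b) the incidence graph $L(\mathcal{N})$; (c) the complement $L^c(\mathcal{N})$ of the incidence graph; (d) the complete graph.
   Context: $D(\mathcal{N})$ is the set of dyads, i.e. unordered pairs $ij$ of distinct nodes of $\mathcal{N}$. A random network on $\mathcal{N}$ is a family $X=(X_d)_{d\in D(\mathcal{N})}$ of $\{0,1\}$-valued random variables, identified with a random simple undirected graph on $\mathcal{N}$ ($X_{ij}=1$ iff $ij$ is an edge). It is exchangeable if its distribution is invariant under every relabeling (permutation) of the nodes. The incidence graph $L(\mathcal{N})$ is the line graph of the complete graph on $\mathcal{N}$: its vertex set is $D(\mathcal{N})$ and two distinct dyads are adjacent iff they share a node. $L^c(\mathcal{N})$ is its complement: two distinct dyads are adjacent iff they are disjoint. The dependence skeleton $\mathrm{sk}(X)$ is the undirected graph with vertex set $D(\mathcal{N})$ in which two distinct dyads $u,v$ are not adjacent if and only if there is some (possibly empty) subset $S\subseteq D(\mathcal{N})\setminus\{u,v\}$ such that $X_u$ and $X_v$ are conditionally independent given $X_S=(X_d)_{d\in S}$. *)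

theory Defs
  imports "HOL-Probability.Probability" "HOL-Combinatorics.Permutations"
begin

text \<open>Simple undirected graphs: a vertex set together with a set of two-element edges.\<close>

record 'v graph =
  verts :: "'v set"
  edges :: "'v set set"

definition dyads :: "'v set \<Rightarrow> 'v set set" where
  "dyads N = {{i, j} | i j. i \<in> N \<and> j \<in> N \<and> i \<noteq> j}"

definition empty_graph :: "'v set \<Rightarrow> 'v graph" where
  "empty_graph V = \<lparr>verts = V, edges = {}\<rparr>"

definition complete_ugraph :: "'v set \<Rightarrow> 'v graph" where
  "complete_ugraph V = \<lparr>verts = V, edges = dyads V\<rparr>"

definition graph_complement :: "'v graph \<Rightarrow> 'v graph" where
  "graph_complement G = \<lparr>verts = verts G, edges = dyads (verts G) - edges G\<rparr>"

definition line_graph :: "'v graph \<Rightarrow> 'v set graph" where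
  "line_graph G = \<lparr>verts = edges G,
     edges = {{e, f} | e f. e \<in> edges G \<and> f \<in> edges G \<and> e \<noteq> f \<and> e \<inter> f \<noteq> {}}\<rparr>"

definition incidence_graph :: "'v set \<Rightarrow> 'v set graph" where
  "incidence_graph N = line_graph (complete_ugraph N)"

text \<open>The values of the family \<open>X\<close> outside \<open>dyads N\<close> are irrelevant.\<close>

definition random_network :: "'w measure \<Rightarrow> 'v set \<Rightarrow> ('v set \<Rightarrow> 'w \<Rightarrow> nat) \<Rightarrow> bool" where
  "random_network M N X \<longleftrightarrow>
     prob_space M \<and> (\<forall>d\<in>dyads N. X d \<in> M \<rightarrow>\<^sub>M count_space {0, 1})"

definition network_law :: "'w measure \<Rightarrow> 'v set \<Rightarrow> ('v set \<Rightarrow> 'w \<Rightarrow> nat) \<Rightarrow> ('v set \<Rightarrow> nat) measure" where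
  "network_law M N X =
     distr M (\<Pi>\<^sub>M d\<in>dyads N. count_space {0, 1}) (\<lambda>\<omega>. \<lambda>d\<in>dyads N. X d \<omega>)"

definition exchangeable :: "'w measure \<Rightarrow> 'v set \<Rightarrow> ('v set \<Rightarrow> 'w \<Rightarrow> nat) \<Rightarrow> bool" where
  "exchangeable M N X \<longleftrightarrow>
     (\<forall>\<sigma>. \<sigma> permutes N \<longrightarrow> network_law M N (\<lambda>d. X (\<sigma> ` d)) = network_law M N X)"

text \<open>Conditional independence of \<open>U\<close> and \<open>V\<close> given \<open>W\<close>. Conditioning on the individual
  values of \<open>W\<close> is meaningful for discrete variables only; here \<open>W\<close> takes finitely many values.\<close>

definition discrete_cond_indep ::
    "'w measure \<Rightarrow> ('w \<Rightarrow> 'a) \<Rightarrow> ('w \<Rightarrow> 'b) \<Rightarrow> ('w \<Rightarrow> 'c) \<Rightarrow> bool" where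
  "discrete_cond_indep M U V W \<longleftrightarrow>
     (\<forall>u v w. \<P>(\<omega> in M. W \<omega> = w) > 0 \<longrightarrow>
        \<P>(\<omega> in M. U \<omega> = u \<and> V \<omega> = v \<bar> W \<omega> = w) =
        \<P>(\<omega> in M. U \<omega> = u \<bar> W \<omega> = w) * \<P>(\<omega> in M. V \<omega> = v \<bar> W \<omega> = w))"

definition skeleton :: "'w measure \<Rightarrow> 'v set \<Rightarrow> ('v set \<Rightarrow> 'w \<Rightarrow> nat) \<Rightarrow> 'v set graph" where
  "skeleton M N X = \<lparr>verts = dyads N,
     edges = {{u, v} | u v. u \<in> dyads N \<and> v \<in> dyads N \<and> u \<noteq> v \<and>
       \<not> (\<exists>S \<subseteq> dyads N - {u, v}.
            discrete_cond_indep M (X u) (X v) (\<lambda>\<omega>. \<lambda>d\<in>S. X d \<omega>))}\<rparr>"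

end

theory Submission
  imports Defs
begin

text \<open>Whether two dyads can be separated by some conditioning set is a property of the law of the
  network alone, so for an exchangeable network it is invariant under relabeling the nodes
  (\<open>separable_relabel\<close>). The symmetric group on the nodes has at most two orbits on the pairs of
  distinct dyads, the pairs that share a node and the disjoint pairs
  (\<open>ex_permutes_map_dyads\<close>). The skeleton therefore contains all or none of the pairs of each
  kind, which leaves the four graphs of the theorem.\<close>

section \<open>Conditional independence\<close>

text \<open>Conditioning uses the variable \<open>W\<close> only through the partition of the sample space into the
  sets on which it is constant, so variables with the same partition are interchangeable.\<close>

lemma discrete_cond_indep_same_partition:
  assumes indep: "discrete_cond_indep M U V W"
    and partition: "\<And>\<omega> \<omega>'. \<omega> \<in> space M \<Longrightarrow> \<omega>' \<in> space M \<Longrightarrow> W \<omega> = W \<omega>' \<longleftrightarrow> W' \<omega> = W' \<omega>'"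
  shows "discrete_cond_indep M U V W'"
  unfolding discrete_cond_indep_def
proof (intro allI impI)
  fix u v w'
  assume pos: "\<P>(\<omega> in M. W' \<omega> = w') > 0"
  then have "{\<omega> \<in> space M. W' \<omega> = w'} \<noteq> {}"
    by (metis less_irrefl measure_empty)
  then obtain \<omega>0 where \<omega>0: "\<omega>0 \<in> space M" "W' \<omega>0 = w'"
    by blast
  have block: "{\<omega> \<in> space M. P \<omega> \<and> W' \<omega> = w'} = {\<omega> \<in> space M. P \<omega> \<and> W \<omega> = W \<omega>0}" for P
    using partition \<omega>0 by auto
  have whole: "{\<omega> \<in> space M. W' \<omega> = w'} = {\<omega> \<in> space M. W \<omega> = W \<omega>0}"
    using block[of "\<lambda>_. True"] by simp
  show "\<P>(\<omega> in M. U \<omega> = u \<and> V \<omega> = v \<bar> W' \<omega> = w') =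
      \<P>(\<omega> in M. U \<omega> = u \<bar> W' \<omega> = w') * \<P>(\<omega> in M. V \<omega> = v \<bar> W' \<omega> = w')"
    using indep pos unfolding discrete_cond_indep_def cond_prob_def block whole by blast
qed

lemma finite_dyads: "finite N \<Longrightarrow> finite (dyads N)"
  by (rule finite_subset[of _ "Pow N"]) (auto simp: dyads_def)

text \<open>With finitely many binary coordinates every set of configurations is measurable; the
  condition \<open>P\<close> can be arbitrary.\<close>

lemma prob_network_law:
  assumes "finite N" and net: "random_network M N X"
  shows "\<P>(\<omega> in M. P (\<lambda>d\<in>dyads N. X d \<omega>)) = \<P>(x in network_law M N X. P x)"
proof -
  let ?C = "\<Pi>\<^sub>M d\<in>dyads N. count_space {0, 1 :: nat}"
  let ?T = "\<lambda>\<omega>. \<lambda>d\<in>dyads N. X d \<omega>"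
  have discrete: "?C = count_space (PiE (dyads N) (\<lambda>_. {0, 1}))"
    by (rule count_space_PiM_finite) (use assms finite_dyads in auto)
  have T: "?T \<in> M \<rightarrow>\<^sub>M ?C"
    using net by (intro measurable_restrict) (auto simp: random_network_def)
  have "{x \<in> space ?C. P x} \<in> sets ?C"
    unfolding discrete by auto
  then have "measure (distr M ?C ?T) {x \<in> space ?C. P x}
      = measure M (?T -` {x \<in> space ?C. P x} \<inter> space M)"
    by (intro measure_distr T)
  also have "?T -` {x \<in> space ?C. P x} \<inter> space M = {\<omega> \<in> space M. P (?T \<omega>)}"
    using measurable_space[OF T] by auto
  finally show ?thesis
    unfolding network_law_def space_distr by (rule sym)
qed

lemma discrete_cond_indep_network_law:
  assumes "finite N" "random_network M N X"
    and "u \<in> dyads N" "v \<in> dyads N" "S \<subseteq> dyads N"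
  shows "discrete_cond_indep M (X u) (X v) (\<lambda>\<omega>. \<lambda>d\<in>S. X d \<omega>) \<longleftrightarrow>
    discrete_cond_indep (network_law M N X) (\<lambda>x. x u) (\<lambda>x. x v) (\<lambda>x. restrict x S)"
proof -
  have S: "dyads N \<inter> S = S"
    using assms(5) by blast
  let ?L = "network_law M N X"
  note law = prob_network_law[OF assms(1,2)]
  have joint: "\<P>(\<omega> in M. (X u \<omega> = i \<and> X v \<omega> = j) \<and> (\<lambda>d\<in>S. X d \<omega>) = w) =
      \<P>(x in ?L. (x u = i \<and> x v = j) \<and> restrict x S = w)" for i j w
    using law[of "\<lambda>x. (x u = i \<and> x v = j) \<and> restrict x S = w"] assms(3,4) by (simp add: S)
  have single: "\<P>(\<omega> in M. X t \<omega> = i \<and> (\<lambda>d\<in>S. X d \<omega>) = w) =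
      \<P>(x in ?L. x t = i \<and> restrict x S = w)" if "t \<in> dyads N" for t i w
    using law[of "\<lambda>x. x t = i \<and> restrict x S = w"] that by (simp add: S)
  have cond: "\<P>(\<omega> in M. (\<lambda>d\<in>S. X d \<omega>) = w) = \<P>(x in ?L. restrict x S = w)" for w
    using law[of "\<lambda>x. restrict x S = w"] by (simp add: S)
  show ?thesis
    unfolding discrete_cond_indep_def cond_prob_def joint single[OF assms(3)] single[OF assms(4)] cond ..
qed

section \<open>Relabeling the nodes\<close>

lemma dyads_eq_card: "dyads N = {d. d \<subseteq> N \<and> card d = 2}"
  by (auto simp: dyads_def card_2_iff)

lemma image_permutes_dyads:
  assumes "\<sigma> permutes N" "d \<in> dyads N"
  shows "\<sigma> ` d \<in> dyads N"
proof -
  have "card (\<sigma> ` d) = card d"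
    by (intro card_image permutes_inj_on[OF assms(1)])
  moreover have "\<sigma> ` d \<subseteq> \<sigma> ` N"
    using assms(2) by (intro image_mono) (simp add: dyads_eq_card)
  ultimately show ?thesis
    using assms(2) by (simp add: dyads_eq_card permutes_image[OF assms(1)])
qed

lemma random_network_relabel:
  "random_network M N X \<Longrightarrow> \<sigma> permutes N \<Longrightarrow> random_network M N (\<lambda>d. X (\<sigma> ` d))"
  by (simp add: random_network_def image_permutes_dyads)

definition separable :: "'w measure \<Rightarrow> 'v set \<Rightarrow> ('v set \<Rightarrow> 'w \<Rightarrow> nat) \<Rightarrow> 'v set \<Rightarrow> 'v set \<Rightarrow> bool" where
  "separable M N X u v \<longleftrightarrow> (\<exists>S \<subseteq> dyads N - {u, v}.
     discrete_cond_indep M (X u) (X v) (\<lambda>\<omega>. \<lambda>d\<in>S. X d \<omega>))"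

text \<open>If \<open>S\<close> separates \<open>u\<close> from \<open>v\<close>, then by exchangeability it also does so in the relabeled
  network, which says that the image of \<open>S\<close> separates the images of \<open>u\<close> and \<open>v\<close> in the original
  one.\<close>

lemma separable_relabel:
  assumes "finite N" "random_network M N X" "exchangeable M N X" "\<sigma> permutes N"
    and u: "u \<in> dyads N" and v: "v \<in> dyads N" and "separable M N X u v"
  shows "separable M N X (\<sigma> ` u) (\<sigma> ` v)"
proof -
  obtain S where S: "S \<subseteq> dyads N - {u, v}"
    and indep: "discrete_cond_indep M (X u) (X v) (\<lambda>\<omega>. \<lambda>d\<in>S. X d \<omega>)"
    using assms(7) unfolding separable_def by blast
  let ?Y = "\<lambda>d. X (\<sigma> ` d)"
  have law: "network_law M N ?Y = network_law M N X"
    using assms(3,4) by (simp add: exchangeable_def)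
  have sub: "S \<subseteq> dyads N"
    using S by blast
  have "discrete_cond_indep M (?Y u) (?Y v) (\<lambda>\<omega>. \<lambda>d\<in>S. ?Y d \<omega>)"
    using indep discrete_cond_indep_network_law[OF assms(1,2) u v sub]
      discrete_cond_indep_network_law[OF assms(1) random_network_relabel[OF assms(2,4)] u v sub] law
    by simp
  \<comment> \<open>Conditioning on the relabeled family over \<open>S\<close> and on the original one over the image
    of \<open>S\<close> is the same: the two families list the same variables under different indices.\<close>
  then have "discrete_cond_indep M (?Y u) (?Y v) (\<lambda>\<omega>. \<lambda>d\<in>(`) \<sigma> ` S. X d \<omega>)"
    by (rule discrete_cond_indep_same_partition) (auto simp: fun_eq_iff restrict_def)
  moreover have "(`) \<sigma> ` S \<subseteq> dyads N - {\<sigma> ` u, \<sigma> ` v}"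
    using S by (auto simp: image_permutes_dyads[OF assms(4)] subset_iff
        inj_image_eq_iff[OF permutes_inj[OF assms(4)]])
  ultimately show ?thesis
    unfolding separable_def by blast
qed

text \<open>Two subsets \<open>u\<close> and \<open>v\<close> of \<open>N\<close> cut it into four disjoint pieces. Up to relabeling,
  the pair is determined by the sizes of these pieces: bijections between corresponding
  pieces glue to a permutation.\<close>

lemma ex_permutes_map_pair:
  fixes N :: "'v set"
  assumes N: "finite N" and sub: "u \<subseteq> N" "v \<subseteq> N" "u' \<subseteq> N" "v' \<subseteq> N"
    and cards: "card u' = card u" "card v' = card v" "card (u' \<inter> v') = card (u \<inter> v)"
  shows "\<exists>\<sigma>. \<sigma> permutes N \<and> \<sigma> ` u = u' \<and> \<sigma> ` v = v'"
proof -
  have fin: "finite u" "finite v" "finite u'" "finite v'"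
    using sub N finite_subset by blast+
  have "card (u - v) = card (u' - v')" "card (v - u) = card (v' - u')"
    using cards fin by (simp_all add: card_Diff_subset_Int Int_commute)
  moreover have "card (u \<union> v) = card (u' \<union> v')"
    using cards fin card_Un_Int[of u v] card_Un_Int[of u' v'] by simp
  then have "card (N - (u \<union> v)) = card (N - (u' \<union> v'))"
    using sub fin by (simp add: card_Diff_subset)
  ultimately obtain f g h k where
    f: "bij_betw f (u \<inter> v) (u' \<inter> v')" and g: "bij_betw g (u - v) (u' - v')" and
    h: "bij_betw h (v - u) (v' - u')" and k: "bij_betw k (N - (u \<union> v)) (N - (u' \<union> v'))"
    using fin N cards(3) by (metis finite_same_card_bij finite_Diff finite_Int)
  define \<sigma> where "\<sigma> x =
    (if x \<in> u then if x \<in> v then f x else g x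
     else if x \<in> v then h x else if x \<in> N then k x else x)" for x
  have f': "bij_betw \<sigma> (u \<inter> v) (u' \<inter> v')"
    by (rule iffD1[OF bij_betw_cong f]) (simp add: \<sigma>_def)
  have g': "bij_betw \<sigma> (u - v) (u' - v')"
    by (rule iffD1[OF bij_betw_cong g]) (simp add: \<sigma>_def)
  have h': "bij_betw \<sigma> (v - u) (v' - u')"
    by (rule iffD1[OF bij_betw_cong h]) (simp add: \<sigma>_def)
  have k': "bij_betw \<sigma> (N - (u \<union> v)) (N - (u' \<union> v'))"
    by (rule iffD1[OF bij_betw_cong k]) (simp add: \<sigma>_def)
  have glue: "(A \<inter> B) \<union> (A - B) = A" "(A \<inter> B) \<union> (B - A) = B" for A B :: "'v set"
    by auto
  have U: "bij_betw \<sigma> u u'"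
    using bij_betw_combine[OF f' g'] unfolding glue by blast
  have V: "bij_betw \<sigma> v v'"
    using bij_betw_combine[OF f' h'] unfolding glue by blast
  have UV: "bij_betw \<sigma> (u \<union> v) (u' \<union> v')"
    using bij_betw_combine[OF U h'] by auto
  have "bij_betw \<sigma> N N"
    using bij_betw_combine[OF UV k'] sub by (auto simp: Un_absorb1)
  moreover have "\<sigma> x = x" if "x \<notin> N" for x
    using that sub by (auto simp: \<sigma>_def)
  ultimately have "\<sigma> permutes N"
    by (rule bij_imp_permutes)
  moreover have "\<sigma> ` u = u'" "\<sigma> ` v = v'"
    using U V by (simp_all add: bij_betw_imp_surj_on)
  ultimately show ?thesis
    by blast
qed

text \<open>Distinct dyads share at most one node, so whether they are disjoint already fixes the size of
  their intersection.\<close>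

lemma ex_permutes_map_dyads:
  assumes "finite N" "u \<in> dyads N" "v \<in> dyads N" "u \<noteq> v"
    and "u' \<in> dyads N" "v' \<in> dyads N" "u' \<noteq> v'"
    and disj: "u \<inter> v = {} \<longleftrightarrow> u' \<inter> v' = {}"
  shows "\<exists>\<sigma>. \<sigma> permutes N \<and> \<sigma> ` u = u' \<and> \<sigma> ` v = v'"
proof -
  have inter: "card (d \<inter> e) = (if d \<inter> e = {} then 0 else 1)"
    if "d \<in> dyads N" "e \<in> dyads N" "d \<noteq> e" for d e
    using that unfolding dyads_def by (auto simp: card_insert_if Int_insert_left)
  show ?thesis
    using assms inter[of u v] inter[of u' v']
    by (intro ex_permutes_map_pair) (auto simp: dyads_eq_card)
qed

section \<open>The possible skeletons\<close>

text \<open>The truth values \<open>p\<close> and \<open>q\<close> decide adjacency for disjoint and for intersecting dyads;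
  each of their four combinations gives one of the four graphs.\<close>

lemma graph_on_dyads_cases:
  fixes N :: "'v set"
  assumes R: "\<And>u v. u \<in> dyads N \<Longrightarrow> v \<in> dyads N \<Longrightarrow> u \<noteq> v \<Longrightarrow>
      R u v \<longleftrightarrow> (if u \<inter> v = {} then p else q)"
  shows "\<lparr>verts = dyads N, edges = {{u, v} | u v. u \<in> dyads N \<and> v \<in> dyads N \<and> u \<noteq> v \<and> R u v}\<rparr> \<in>
    {empty_graph (dyads N), incidence_graph N,
     graph_complement (incidence_graph N), complete_ugraph (dyads N)}"
proof -
  let ?E = "\<lambda>Q. {{u, v} | u v. u \<in> dyads N \<and> v \<in> dyads N \<and> u \<noteq> v \<and> Q u v}"
  let ?meet = "\<lambda>u v :: 'v set. u \<inter> v \<noteq> {}"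
  have all: "dyads (dyads N) = ?E (\<lambda>_ _. True)"
    by (simp add: dyads_def[of "dyads N"])
  have incidence: "incidence_graph N = \<lparr>verts = dyads N, edges = ?E ?meet\<rparr>"
    by (simp add: incidence_graph_def line_graph_def complete_ugraph_def)
  have "dyads (dyads N) - ?E ?meet = ?E (\<lambda>u v. u \<inter> v = {})"
  proof (intro set_eqI iffI)
    fix e
    assume e: "e \<in> dyads (dyads N) - ?E ?meet"
    then obtain u v where uv: "e = {u, v}" "u \<in> dyads N" "v \<in> dyads N" "u \<noteq> v"
      unfolding all by blast
    then have "u \<inter> v = {}"
      using e by blast
    with uv show "e \<in> ?E (\<lambda>u v. u \<inter> v = {})"
      by blast
  next
    fix e
    assume "e \<in> ?E (\<lambda>u v. u \<inter> v = {})"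
    then obtain u v where uv: "e = {u, v}" "u \<in> dyads N" "v \<in> dyads N" "u \<noteq> v" "u \<inter> v = {}"
      by blast
    then have "x \<inter> y = {}" if "e = {x, y}" for x y
      using that by (metis doubleton_eq_iff Int_commute)
    then have "e \<notin> ?E ?meet"
      by blast
    with uv show "e \<in> dyads (dyads N) - ?E ?meet"
      unfolding all by blast
  qed
  then have complement: "graph_complement (incidence_graph N) =
      \<lparr>verts = dyads N, edges = ?E (\<lambda>u v. u \<inter> v = {})\<rparr>"
    by (simp add: graph_complement_def incidence)
  have E: "?E R = ?E (\<lambda>u v. if u \<inter> v = {} then p else q)"
    using R by blast
  show ?thesis
    unfolding E complement
    unfolding incidence complete_ugraph_def all empty_graph_def
    by (cases p; cases q) (simp_all add: if_bool_eq_conj)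
qed

theorem proposition3:
  fixes M :: "'w measure" and N :: "'v set" and X :: "'v set \<Rightarrow> 'w \<Rightarrow> nat"
  assumes "finite N"
    and "random_network M N X"
    and "exchangeable M N X"
  shows "skeleton M N X \<in>
    {empty_graph (dyads N),
     incidence_graph N,
     graph_complement (incidence_graph N),
     complete_ugraph (dyads N)}"
proof -
  let ?R = "\<lambda>u v. \<not> separable M N X u v"
  let ?pair = "\<lambda>u v. u \<in> dyads N \<and> v \<in> dyads N \<and> u \<noteq> v"
  have orbit: "?R u v" if "?pair u v" "?pair u' v'" "u \<inter> v = {} \<longleftrightarrow> u' \<inter> v' = {}" "?R u' v'"
    for u v u' v'
    using that ex_permutes_map_dyads[OF assms(1), of u v u' v'] separable_relabel[OF assms]
    by blast
  have "?R u v \<longleftrightarrow> (if u \<inter> v = {} then \<exists>u v. ?pair u v \<and> u \<inter> v = {} \<and> ?R u v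
      else \<exists>u v. ?pair u v \<and> u \<inter> v \<noteq> {} \<and> ?R u v)" if "?pair u v" for u v
    using that orbit[of u v] by (cases "u \<inter> v = {}") (simp, blast)+
  then show ?thesis
    unfolding skeleton_def separable_def[symmetric] by (intro graph_on_dyads_cases) blast
qed

end
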